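(* Let $f:\mathbb{R}^n\to\mathbb{R}^n$ be a $C^1$ vector field with flow $\phi_t$, let $X\subseteq\mathbb{R}^n$ be a compact forward invariant set, and suppose that $\dot x=f(x)$ is nonexpansive on $X$ with respect to a norm $\|\cdot\|$ on $\mathbb{R}^n$. Let $\mathbb{A}=\bigcap_{t\ge0}\phi_t(X)$. Then for every real $t\ge0$ the map $\phi_t$ is an isometry on $\mathbb{A}$, that is, $\|\phi_t(x)-\phi_t(y)\|=\|x-y\|$ for all $x,y\in\mathbb{A}$.
   Context: $\phi_t$ denotes the forward time evolution of $\dot x=f(x)$, assumed to be defined for all $t\ge0$. The system is nonexpansive on $X$ with respect to $\|\cdot\|$ if $\|\phi_t(x)-\phi_t(y)\|\le\|x-y\|$ for all $x,y\in X$ and all $t>0$. The set $\mathbb{A}$ is called the global attractor of the system relative to the state space $X$. *)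

theory Defs
  imports "HOL-Analysis.Analysis"
begin

text \<open>The norm of the problem is arbitrary and need not be the Euclidean norm
  that the type class supplies on \<^typ>\<open>real ^ 'n\<close>, so it is carried as a function.\<close>

definition is_norm :: "('a::real_vector \<Rightarrow> real) \<Rightarrow> bool" where
  "is_norm N \<longleftrightarrow>
     (\<forall>x. 0 \<le> N x) \<and>
     (\<forall>x. N x = 0 \<longleftrightarrow> x = 0) \<and>
     (\<forall>c x. N (c *\<^sub>R x) = \<bar>c\<bar> * N x) \<and>
     (\<forall>x y. N (x + y) \<le> N x + N y)"

definition C1_vector_field :: "('a::real_normed_vector \<Rightarrow> 'a) \<Rightarrow> bool" where
  "C1_vector_field f \<longleftrightarrow>
     (\<exists>f' :: 'a \<Rightarrow> 'a \<Rightarrow>\<^sub>L 'a.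
        (\<forall>x. (f has_derivative blinfun_apply (f' x)) (at x)) \<and> continuous_on UNIV f')"

text \<open>\<open>\<phi> t x\<close> is the value at time \<open>t\<close> of the solution starting at \<open>x\<close>; only \<open>t \<ge> 0\<close>
  is constrained, and the derivative at \<open>t = 0\<close> is one-sided. Solutions are required to exist
  for all forward times. For a \<open>C\<^sup>1\<close> field they are unique, so \<open>\<phi>\<close> is
  determined by \<open>f\<close> on \<open>t \<ge> 0\<close>.\<close>

definition forward_flow ::
  "('a::real_normed_vector \<Rightarrow> 'a) \<Rightarrow> (real \<Rightarrow> 'a \<Rightarrow> 'a) \<Rightarrow> bool" where
  "forward_flow f \<phi> \<longleftrightarrow>
     (\<forall>x. \<phi> 0 x = x \<and>
        (\<forall>t\<ge>0. ((\<lambda>s. \<phi> s x) has_vector_derivative f (\<phi> t x)) (at t within {0..})))"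

definition forward_invariant :: "(real \<Rightarrow> 'a \<Rightarrow> 'a) \<Rightarrow> 'a set \<Rightarrow> bool" where
  "forward_invariant \<phi> X \<longleftrightarrow> (\<forall>t\<ge>0. \<phi> t ` X \<subseteq> X)"

definition nonexpansive_on ::
  "('a::real_vector \<Rightarrow> real) \<Rightarrow> (real \<Rightarrow> 'a \<Rightarrow> 'a) \<Rightarrow> 'a set \<Rightarrow> bool" where
  "nonexpansive_on N \<phi> X \<longleftrightarrow>
     (\<forall>x\<in>X. \<forall>y\<in>X. \<forall>t>0. N (\<phi> t x - \<phi> t y) \<le> N (x - y))"

definition global_attractor :: "(real \<Rightarrow> 'a \<Rightarrow> 'a) \<Rightarrow> 'a set \<Rightarrow> 'a set" where
  "global_attractor \<phi> X = (\<Inter>t\<in>{0..}. \<phi> t ` X)"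

end

theory Submission imports Defs begin

text \<open>The flow \<open>\<phi>\<^sub>t\<close> never increases a distance, so the task is to see that it cannot decrease one
  between two points \<open>x, y\<close> of the attractor. Write \<open>g = \<phi>\<^sub>t\<close>. Both points have backward
  \<open>g\<close>-orbits of any prescribed length inside \<open>X\<close>, and along such orbits the distance between
  the two points can only grow with the number of backward steps. By compactness a sufficiently
  long pair of backward orbits nearly returns to itself after some \<open>p \<ge> 1\<close> steps. Pushing that
  near-return forward with the nonexpansive map \<open>g\<close> shows that the points \<open>x', y'\<close> reached from
  \<open>g x, g y\<close> after \<open>p\<close> backward steps are close to \<open>g x, g y\<close> themselves. As \<open>x', y'\<close> precede
  \<open>x, y\<close> or equal them, they are at least as far apart as \<open>x, y\<close>; hence so, up to an arbitrarily
  small error, are \<open>g x, g y\<close>. This is \<open>nonexpansive_isometric_on_eventual_image\<close>, the finite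
  form of the theorem that a nonexpansive surjection of a compact metric space is an isometry.

  Points of the attractor have such backward orbits because \<open>\<phi>\<close> is a semigroup on \<open>X\<close>, so that
  \<open>\<phi>\<^sub>k\<^sub>t\<close> is the \<open>k\<close>-th iterate of \<open>g\<close>. The semigroup law is uniqueness of solutions,
  proved by Gronwall's argument from the Lipschitz bound that a \<open>C\<^sup>1\<close> field satisfies on a ball
  containing \<open>X\<close>.\<close>

section \<open>Nonexpansive self-maps of totally bounded spaces\<close>

lemma nonexpansive_funpow:
  fixes d :: "'a \<Rightarrow> 'a \<Rightarrow> real"
  assumes maps: "g ` X \<subseteq> X"
    and nonexp: "\<And>x y. x \<in> X \<Longrightarrow> y \<in> X \<Longrightarrow> d (g x) (g y) \<le> d x y"
    and "x \<in> X" "y \<in> X"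
  shows "(g ^^ k) x \<in> X \<and> (g ^^ k) y \<in> X \<and> d ((g ^^ k) x) ((g ^^ k) y) \<le> d x y"
proof (induction k)
  case 0
  then show ?case using assms by simp
next
  case (Suc k)
  then have "d ((g ^^ Suc k) x) ((g ^^ Suc k) y) \<le> d ((g ^^ k) x) ((g ^^ k) y)"
    using nonexp by simp
  then show ?case using Suc maps by auto
qed

text \<open>The near-return comes from the pigeonhole principle applied to a finite cover of
  \<open>X \<times> X\<close> by small sets: the number of cells of the cover tells how long the backward orbits
  must be.\<close>

lemma nonexpansive_isometric_on_eventual_image:
  fixes d :: "'a \<Rightarrow> 'a \<Rightarrow> real"
  assumes sym: "\<And>x y. d x y = d y x"
    and triangle: "\<And>x y z. d x z \<le> d x y + d y z"
    and totally_bounded: "\<And>e. e > 0 \<Longrightarrow> \<exists>F. finite F \<and> (\<forall>x\<in>X. \<exists>c\<in>F. d c x < e)"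
    and maps: "g ` X \<subseteq> X"
    and nonexp: "\<And>x y. x \<in> X \<Longrightarrow> y \<in> X \<Longrightarrow> d (g x) (g y) \<le> d x y"
    and x: "\<And>k. x \<in> (g ^^ k) ` X"
    and y: "\<And>k. y \<in> (g ^^ k) ` X"
  shows "d (g x) (g y) = d x y"
proof (rule antisym)
  have iterate: "(g ^^ k) u \<in> X \<and> (g ^^ k) v \<in> X \<and> d ((g ^^ k) u) ((g ^^ k) v) \<le> d u v"
    if "u \<in> X" "v \<in> X" for u v k
    by (rule nonexpansive_funpow) (use maps nonexp that in auto)
  have xyX: "x \<in> X" "y \<in> X" using x[of 0] y[of 0] by auto
  then show "d (g x) (g y) \<le> d x y" by (rule nonexp)
  show "d x y \<le> d (g x) (g y)"
  proof (rule field_le_epsilon)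
    fix \<epsilon> :: real
    assume "\<epsilon> > 0"
    then obtain F where F: "finite F" "\<forall>u\<in>X. \<exists>c\<in>F. d c u < \<epsilon> / 4"
      using totally_bounded[of "\<epsilon> / 4"] by auto
    then obtain c where c: "\<And>u. u \<in> X \<Longrightarrow> c u \<in> F" "\<And>u. u \<in> X \<Longrightarrow> d (c u) u < \<epsilon> / 4"
      by metis
    define n where "n = card (F \<times> F)"
    obtain z w where zw: "z \<in> X" "w \<in> X" "x = (g ^^ n) z" "y = (g ^^ n) w"
      using x[of n] y[of n] by auto
    have inX: "(g ^^ k) z \<in> X" "(g ^^ k) w \<in> X" for k
      using iterate[OF zw(1,2)] by auto
    define cell where "cell k = (c ((g ^^ k) z), c ((g ^^ k) w))" for k
    have "cell ` {..n} \<subseteq> F \<times> F"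
      using c(1) inX unfolding cell_def by auto
    then have "card (cell ` {..n}) \<le> n"
      using F(1) unfolding n_def by (intro card_mono) auto
    then have "\<not> inj_on cell {..n}"
      by (metis card_atMost card_image not_less_eq_eq order_refl)
    then obtain a b where ab: "a < b" "b \<le> n" "cell a = cell b"
      unfolding inj_on_def by (metis atMost_iff linorder_neqE_nat)
    \<comment> \<open>the orbits nearly return between times \<open>a\<close> and \<open>b\<close>; the shift by \<open>m\<close> moves \<open>b\<close> to the
      time \<open>n + 1\<close>, at which the orbits are at \<open>g x\<close> and \<open>g y\<close>\<close>
    define m where "m = n + 1 - b"
    define x' y' where "x' = (g ^^ (m + a)) z" and "y' = (g ^^ (m + a)) w"
    have return: "d ((g ^^ (m + a)) v) ((g ^^ (m + b)) v) < \<epsilon> / 2"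
      if "\<And>k. (g ^^ k) v \<in> X" "c ((g ^^ a) v) = c ((g ^^ b) v)" for v
    proof -
      have "d ((g ^^ (m + a)) v) ((g ^^ (m + b)) v) \<le> d ((g ^^ a) v) ((g ^^ b) v)"
        using iterate[OF that(1)[of a] that(1)[of b], of m]
        by (simp add: funpow_add)
      also have "\<dots> < \<epsilon> / 2"
        using triangle[of "(g ^^ a) v" "(g ^^ b) v" "c ((g ^^ a) v)"]
          c(2)[OF that(1)[of a]] c(2)[OF that(1)[of b]] that(2)
          sym[of "c ((g ^^ a) v)" "(g ^^ a) v"]
        by simp
      finally show ?thesis .
    qed
    have time: "m + b = Suc n" using ab unfolding m_def by simp
    have near: "d x' (g x) < \<epsilon> / 2" "d y' (g y) < \<epsilon> / 2"
      using return[of z] return[of w] inX ab(3)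
      unfolding x'_def y'_def cell_def zw(3,4) time by auto
    have "(g ^^ (n - (m + a))) ((g ^^ (m + a)) v) = (g ^^ n) v" for v
      using ab funpow_add[of "n - (m + a)" "m + a" g] unfolding m_def by simp
    then have "(g ^^ (n - (m + a))) x' = x" "(g ^^ (n - (m + a))) y' = y"
      unfolding x'_def y'_def zw(3,4) by auto
    then have "d x y \<le> d x' y'"
      using iterate[of x' y' "n - (m + a)"] inX[of "m + a"]
      unfolding x'_def y'_def by simp
    also have "d x' y' \<le> d x' (g x) + d (g x) (g y) + d (g y) y'"
      using triangle[of x' y' "g x"] triangle[of "g x" y' "g y"] by linarith
    also have "\<dots> \<le> d (g x) (g y) + \<epsilon>"
      using near sym[of y' "g y"] by linarith
    finally show "d x y \<le> d (g x) (g y) + \<epsilon>" .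
  qed
qed

section \<open>Arbitrary norms on a Euclidean space\<close>

text \<open>This half of the equivalence of norms puts Euclidean balls inside \<open>N\<close>-balls, which carries
  total boundedness of compact sets over to \<open>N\<close>.\<close>

lemma is_norm_le_norm:
  fixes N :: "'a::euclidean_space \<Rightarrow> real"
  assumes "is_norm N"
  obtains C where "C > 0" "\<And>v. N v \<le> C * norm v"
proof
  have N: "0 \<le> N v" "N (c *\<^sub>R v) = \<bar>c\<bar> * N v" "N (v + w) \<le> N v + N w" "N 0 = 0" for v w c
    using assms unfolding is_norm_def by auto
  have N_sum: "N (sum h B) \<le> (\<Sum>b\<in>B. N (h b))" if "finite B" for h :: "'a \<Rightarrow> 'a" and B
    using that by (induction B) (auto intro: order_trans[OF N(3)] simp: N(4))
  show "0 < (\<Sum>b\<in>Basis. N b) + 1"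
    by (simp add: N(1) sum_nonneg add_nonneg_pos)
  show "N v \<le> ((\<Sum>b\<in>Basis. N b) + 1) * norm v" for v :: 'a
  proof -
    have "N v = N (\<Sum>b\<in>Basis. (v \<bullet> b) *\<^sub>R b)" by (simp add: euclidean_representation)
    also have "\<dots> \<le> (\<Sum>b\<in>Basis. \<bar>v \<bullet> b\<bar> * N b)"
      using N_sum[OF finite_Basis, of "\<lambda>b. (v \<bullet> b) *\<^sub>R b"] by (simp add: N(2))
    also have "\<dots> \<le> (\<Sum>b\<in>Basis. norm v * N b)"
      by (intro sum_mono mult_right_mono Basis_le_norm N(1))
    also have "\<dots> \<le> ((\<Sum>b\<in>Basis. N b) + 1) * norm v"
      by (simp add: sum_distrib_left algebra_simps)
    finally show ?thesis .
  qed
qed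

lemma compact_imp_finite_net_is_norm:
  fixes N :: "'a::euclidean_space \<Rightarrow> real"
  assumes "is_norm N" "compact X" "e > 0"
  shows "\<exists>F. finite F \<and> (\<forall>x\<in>X. \<exists>c\<in>F. N (c - x) < e)"
proof -
  obtain C where C: "C > 0" "\<And>v. N v \<le> C * norm v"
    using is_norm_le_norm[OF assms(1)] by blast
  obtain F where F: "finite F" "X \<subseteq> (\<Union>c\<in>F. ball c (e / C))"
    using assms(2,3) C(1) unfolding compact_eq_totally_bounded by (meson divide_pos_pos)
  have "N (c - x) < e" if "x \<in> ball c (e / C)" for c x
    using that C(1) C(2)[of "c - x"] by (simp add: dist_norm field_simps)
  then have "\<exists>c\<in>F. N (c - x) < e" if "x \<in> X" for x
    using F(2) that by (meson UN_E subsetD)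
  then show ?thesis using F(1) by (intro exI[of _ F]) simp
qed

section \<open>Uniqueness of solutions and the semigroup law\<close>

lemma C1_vector_field_lipschitz_on_cball:
  fixes f :: "'a::euclidean_space \<Rightarrow> 'a"
  assumes "C1_vector_field f"
  obtains L where "L-lipschitz_on (cball 0 R) f"
proof -
  obtain f' :: "'a \<Rightarrow> 'a \<Rightarrow>\<^sub>L 'a"
    where f': "\<And>x. (f has_derivative blinfun_apply (f' x)) (at x)" "continuous_on UNIV f'"
    using assms unfolding C1_vector_field_def by blast
  have "compact (f' ` cball 0 R)"
    by (intro compact_continuous_image continuous_on_subset[OF f'(2)]) auto
  then obtain L where L: "L > 0" "\<forall>x\<in>cball 0 R. norm (f' x) \<le> L"
    using compact_imp_bounded bounded_pos by (metis image_eqI)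
  have "L-lipschitz_on (cball 0 R) f"
  proof (rule bounded_derivative_imp_lipschitz)
    show "(f has_derivative blinfun_apply (f' z)) (at z within cball 0 R)" for z
      using f'(1) has_derivative_at_withinI by blast
    show "onorm (blinfun_apply (f' z)) \<le> L" if "z \<in> cball 0 R" for z
      using L(2) that by (simp add: norm_blinfun.rep_eq)
  qed (use L(1) in auto)
  then show thesis by (rule that)
qed

text \<open>Gronwall's argument: with \<open>D = \<parallel>u - v\<parallel>\<^sup>2\<close> the Lipschitz bound gives \<open>D' \<le> 2 L D\<close>, so
  \<open>D\<close> times \<open>exp (-2 L s)\<close> is nonincreasing, and it starts at zero.\<close>

lemma lipschitz_solution_unique:
  fixes f :: "'a::real_inner \<Rightarrow> 'a" and u v :: "real \<Rightarrow> 'a"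
  assumes lip: "L-lipschitz_on S f"
    and u: "\<And>s. s \<ge> 0 \<Longrightarrow> (u has_vector_derivative f (u s)) (at s within {0..})"
    and v: "\<And>s. s \<ge> 0 \<Longrightarrow> (v has_vector_derivative f (v s)) (at s within {0..})"
    and uS: "\<And>s. s \<ge> 0 \<Longrightarrow> u s \<in> S"
    and vS: "\<And>s. s \<ge> 0 \<Longrightarrow> v s \<in> S"
    and init: "u 0 = v 0"
    and "s \<ge> 0"
  shows "u s = v s"
proof -
  define E where "E r = ((u r - v r) \<bullet> (u r - v r)) * exp (- 2 * L * r)" for r
  define E' where "E' r = (2 * ((u r - v r) \<bullet> (f (u r) - f (v r)))
      - 2 * L * ((u r - v r) \<bullet> (u r - v r))) * exp (- 2 * L * r)" for r
  have E: "(E has_vector_derivative E' r) (at r within {0..})" if "r \<ge> 0" for r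
    unfolding E_def E'_def has_vector_derivative_def
    by (rule derivative_eq_intros u[OF that, unfolded has_vector_derivative_def]
          v[OF that, unfolded has_vector_derivative_def] refl)+
      (auto simp: fun_eq_iff algebra_simps inner_commute)
  have E'_nonpos: "E' r \<le> 0" if "r \<ge> 0" for r
  proof -
    have "(u r - v r) \<bullet> (f (u r) - f (v r)) \<le> norm (u r - v r) * norm (f (u r) - f (v r))"
      by (rule norm_cauchy_schwarz)
    also have "\<dots> \<le> norm (u r - v r) * (L * norm (u r - v r))"
      using lipschitz_onD[OF lip uS[OF that] vS[OF that]]
      by (intro mult_left_mono) (auto simp: dist_norm)
    also have "\<dots> = L * ((u r - v r) \<bullet> (u r - v r))"
      by (simp add: dot_square_norm power2_eq_square)
    finally show ?thesis unfolding E'_def by (intro mult_nonpos_nonneg) auto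
  qed
  have "E s \<le> E 0"
  proof (rule DERIV_nonpos_imp_decreasing_open[OF \<open>s \<ge> 0\<close>])
    show "\<exists>y. (E has_real_derivative y) (at r) \<and> y \<le> 0" if "0 < r" "r < s" for r
    proof -
      have "at r within {0..} = at r" using that by (intro at_within_interior) auto
      then show ?thesis using E[of r] E'_nonpos[of r] that
        by (auto simp: has_real_derivative_iff_has_vector_derivative)
    qed
    have "continuous_on {0..} E"
      unfolding continuous_on_eq_continuous_within
      by (metis E atLeast_iff has_vector_derivative_continuous)
    then show "continuous_on {0..s} E" by (rule continuous_on_subset) auto
  qed
  then have "(u s - v s) \<bullet> (u s - v s) \<le> 0"
    using init by (simp add: E_def mult_le_0_iff)
  then have "u s - v s = 0" by (metis inner_eq_zero_iff inner_ge_zero order_antisym)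
  then show ?thesis by simp
qed

text \<open>As functions of \<open>s\<close>, both sides solve the equation, start at \<open>\<phi> t x\<close> and stay in \<open>X\<close>,
  where the field is Lipschitz.\<close>

lemma forward_flow_semigroup:
  fixes f :: "'a::euclidean_space \<Rightarrow> 'a"
  assumes "C1_vector_field f" and flow: "forward_flow f \<phi>" and "compact X"
    and inv: "forward_invariant \<phi> X" and "x \<in> X" "t \<ge> 0" "s \<ge> 0"
  shows "\<phi> (s + t) x = \<phi> s (\<phi> t x)"
proof -
  obtain R where R: "X \<subseteq> cball 0 R"
    using compact_imp_bounded[OF \<open>compact X\<close>] by (metis bounded_iff mem_cball_0 subsetI)
  obtain L where "L-lipschitz_on (cball 0 R) f"
    using C1_vector_field_lipschitz_on_cball[OF assms(1)] .
  then have lip: "L-lipschitz_on X f" using R by (rule lipschitz_on_subset)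
  have sol: "((\<lambda>r. \<phi> r y) has_vector_derivative f (\<phi> r y)) (at r within {0..})"
    if "r \<ge> 0" for r y
    using flow that unfolding forward_flow_def by blast
  have inX: "\<phi> r y \<in> X" if "r \<ge> 0" "y \<in> X" for r y
    using inv that unfolding forward_invariant_def by blast
  have shift: "((\<lambda>r. \<phi> (r + t) x) has_vector_derivative f (\<phi> (r + t) x)) (at r within {0..})"
    if "r \<ge> 0" for r
  proof -
    have "((\<lambda>r. r + t) has_vector_derivative 1) (at r within {0..})"
      by (auto intro!: derivative_eq_intros)
    moreover have "((\<lambda>r. \<phi> r x) has_vector_derivative f (\<phi> (r + t) x))
        (at (r + t) within (\<lambda>r. r + t) ` {0..})"
      by (rule has_vector_derivative_within_subset[OF sol]) (use that \<open>t \<ge> 0\<close> in auto)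
    ultimately show ?thesis
      using vector_diff_chain_within by (fastforce simp: o_def)
  qed
  show ?thesis
    by (rule lipschitz_solution_unique[OF lip shift sol])
      (use inX flow assms(5-7) in \<open>auto simp: forward_flow_def\<close>)
qed

lemma forward_flow_funpow:
  fixes f :: "'a::euclidean_space \<Rightarrow> 'a"
  assumes "C1_vector_field f" "forward_flow f \<phi>" "compact X" "forward_invariant \<phi> X"
    and "x \<in> X" "t \<ge> 0"
  shows "(\<phi> t ^^ k) x = \<phi> (real k * t) x"
proof (induction k)
  case 0
  then show ?case using assms(2) by (simp add: forward_flow_def)
next
  case (Suc k)
  then show ?case
    using forward_flow_semigroup[OF assms(1-5), of "real k * t" t] assms(6)
    by (simp add: algebra_simps)
qed

section \<open>The flow on the attractor\<close>

theorem corollary2: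
  fixes f :: "real ^ 'n \<Rightarrow> real ^ 'n"
    and \<phi> :: "real \<Rightarrow> real ^ 'n \<Rightarrow> real ^ 'n"
    and N :: "real ^ 'n \<Rightarrow> real"
    and X :: "(real ^ 'n) set"
  assumes "C1_vector_field f"
    and "forward_flow f \<phi>"
    and "compact X"
    and "forward_invariant \<phi> X"
    and "is_norm N"
    and "nonexpansive_on N \<phi> X"
  shows "\<forall>t\<ge>0. \<forall>x\<in>global_attractor \<phi> X. \<forall>y\<in>global_attractor \<phi> X.
           N (\<phi> t x - \<phi> t y) = N (x - y)"
proof (intro allI impI ballI)
  fix t :: real and x y
  assume t: "t \<ge> 0" and xy: "x \<in> global_attractor \<phi> X" "y \<in> global_attractor \<phi> X"
  have orbit: "z \<in> (\<phi> t ^^ k) ` X" if "z \<in> global_attractor \<phi> X" for z k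
  proof -
    have "z \<in> \<phi> (real k * t) ` X" using that t unfolding global_attractor_def by auto
    then show ?thesis using forward_flow_funpow[OF assms(1-4) _ t] by (auto simp: image_iff)
  qed
  have scale: "N (c *\<^sub>R v) = \<bar>c\<bar> * N v" and add: "N (v + w) \<le> N v + N w" for c v w
    using assms(5) unfolding is_norm_def by auto
  show "N (\<phi> t x - \<phi> t y) = N (x - y)"
  proof (rule nonexpansive_isometric_on_eventual_image[where d = "\<lambda>a b. N (a - b)" and X = X])
    show "N (a - b) = N (b - a)" for a b
      using scale[of "-1" "a - b"] by simp
    show "N (a - c) \<le> N (a - b) + N (b - c)" for a b c
      using add[of "a - b" "b - c"] by simp
    show "\<exists>F. finite F \<and> (\<forall>x\<in>X. \<exists>c\<in>F. N (c - x) < e)" if "e > 0" for e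
      using compact_imp_finite_net_is_norm[OF assms(5,3) that] .
    show "\<phi> t ` X \<subseteq> X"
      using assms(4) t unfolding forward_invariant_def by blast
    show "N (\<phi> t a - \<phi> t b) \<le> N (a - b)" if "a \<in> X" "b \<in> X" for a b
      using assms(2,6) t that unfolding nonexpansive_on_def forward_flow_def
      by (cases "t = 0") auto
  qed (use orbit xy in auto)
qed

end
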